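(* Let $p$ be a prime number and let $\zeta$ be a primitive $p$-th root of unity. Then $$\prod_{j\in\mathbb{F}_p^\times}(1-\zeta^j)=p.$$
   Context: $\mathbb{F}_p^\times$ is the set of nonzero residues modulo $p$; $\zeta^j$ is well defined for $j\in\mathbb{F}_p$ because $\zeta^p=1$. *)

theory Defs
  imports "HOL-Number_Theory.Residues"
begin

definition primitive_root_of_unity :: "nat \<Rightarrow> 'a::field \<Rightarrow> bool"
  where "primitive_root_of_unity n z \<longleftrightarrow>
    n > 0 \<and> z ^ n = 1 \<and> (\<forall>k. 0 < k \<and> k < n \<longrightarrow> z ^ k \<noteq> 1)"

text \<open>
  The elements of \<^term>\<open>residue_ring m\<close> are the integers from 0 to \<open>m - 1\<close>, used as
  representatives of the residue classes.
\<close>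

definition nonzero_residues :: "nat \<Rightarrow> int set"
  where "nonzero_residues p =
    carrier (residue_ring (int p)) - {\<zero>\<^bsub>residue_ring (int p)\<^esub>}"

text \<open>A power of an n-th root of unity depends only on the exponent modulo n.\<close>

lemma root_of_unity_powi_cong:
  fixes z :: "'a::field"
  assumes "n > 0" "z ^ n = 1" "[i = j] (mod int n)"
  shows "z powi i = z powi j"
proof -
  from assms(3) obtain k where k: "i = j + int n * k"
    by (metis cong_iff_lin cong_sym)
  have "z \<noteq> 0"
    using assms(1,2) by (auto simp: power_0_left)
  then show ?thesis
    by (simp add: k power_int_add power_int_mult assms(2))
qed

end

theory Submission
  imports Defs "HOL-Computational_Algebra.Polynomial"
begin

text \<open>
  The powers of \<open>\<zeta>\<close> other than 1 are \<open>n - 1\<close> distinct roots of the monic polynomial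
  \<open>1 + X + \<dots> + X\<^sup>n\<^sup>-\<^sup>1\<close>, which therefore splits as the product of the
  \<open>X - \<zeta>\<^sup>k\<close>; evaluate both sides at 1.
\<close>

text \<open>If two powers agreed, cancelling the smaller one would give
  \<open>z ^ (j - i) = 1\<close> with \<open>0 < j - i < n\<close>, against primitivity.\<close>

lemma primitive_root_of_unity_inj_on:
  assumes "primitive_root_of_unity n z"
  shows "inj_on (\<lambda>k. z ^ k) {..<n}"
proof (rule linorder_inj_onI)
  fix i j
  assume ij: "i < j" and "i \<in> {..<n}" "j \<in> {..<n}"
  then have "z ^ (j - i) \<noteq> 1"
    using assms by (auto simp: primitive_root_of_unity_def)
  moreover have "z \<noteq> 0"
    using assms by (auto simp: primitive_root_of_unity_def power_0_left)
  moreover have "z ^ j = z ^ i * z ^ (j - i)"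
    using ij by (simp flip: power_add)
  ultimately show "z ^ i \<noteq> z ^ j"
    by simp
qed auto

text \<open>The coefficients at degree \<open>n - 1\<close> agree, so the difference of the two
  sides, if nonzero, has degree below \<open>n - 1\<close>; yet it vanishes at \<open>n - 1\<close>
  distinct points.\<close>

lemma sum_monom_eq_prod_primitive_root:
  fixes z :: "'a::field"
  assumes "primitive_root_of_unity n z"
  shows "(\<Sum>i<n. monom 1 i) = (\<Prod>k\<in>{1..<n}. [:- (z ^ k), 1:])"
    (is "?S = ?P")
proof (rule poly_eqI_degree_lead_coeff)
  let ?A = "(\<lambda>k. z ^ k) ` {1..<n}"
  have n: "n > 0" and zn: "z ^ n = 1"
    using assms by (auto simp: primitive_root_of_unity_def)
  have "inj_on (\<lambda>k. z ^ k) {1..<n}"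
    by (rule inj_on_subset[OF primitive_root_of_unity_inj_on[OF assms]]) auto
  then show "card ?A \<ge> n - 1"
    by (simp add: card_image)
  have deg: "degree ?P = n - 1"
    by (subst degree_prod_eq_sum_degree) auto
  then show "degree ?P \<le> n - 1"
    by simp
  show "degree ?S \<le> n - 1"
    by (rule degree_sum_le) (auto intro: order.trans[OF degree_monom_le])
  have "coeff ?P (n - 1) = lead_coeff ?P"
    by (simp only: deg)
  \<comment> \<open>Both are 1; on the left because \<open>n > 0\<close> puts \<open>n - 1\<close>
    in the range of summation.\<close>
  then show "coeff ?S (n - 1) = coeff ?P (n - 1)"
    using n by (simp add: coeff_sum lead_coeff_prod)
  fix x
  assume "x \<in> ?A"
  then obtain k where k: "0 < k" "k < n" and x: "x = z ^ k"
    by (auto simp: Suc_le_eq)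
  then have "x \<noteq> 1"
    using assms by (auto simp: primitive_root_of_unity_def)
  moreover have "x ^ n = 1"
    by (metis x zn power_commutes power_mult mult.commute power_one)
  \<comment> \<open>As \<open>x \<noteq> 1\<close>, the sum is \<open>(x ^ n - 1) / (x - 1)\<close>,
    whose numerator is 0.\<close>
  ultimately have "poly ?S x = 0"
    by (simp add: poly_sum poly_monom geometric_sum)
  moreover have "poly ?P x = 0"
    using k by (auto simp: poly_prod x)
  ultimately show "poly ?S x = poly ?P x"
    by simp
qed

text \<open>Lets the product over residues be reindexed by natural exponents, so that
  \<open>powi\<close> becomes the ordinary power.\<close>

lemma nonzero_residues_eq:
  assumes "n > 1"
  shows "nonzero_residues n = int ` {1..<n}"
proof -
  interpret residues "int n" "residue_ring (int n)"
    using assms by unfold_locales auto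
  show ?thesis
    by (auto simp: nonzero_residues_def res_carrier_eq res_zero_eq image_int_atLeastLessThan)
qed

theorem corollary3p5:
  fixes p :: nat and \<zeta> :: "'a::field"
  assumes "prime p"
    and "primitive_root_of_unity p \<zeta>"
  shows "(\<Prod>j\<in>nonzero_residues p. 1 - \<zeta> powi j) = of_nat p"
proof -
  have "(\<Prod>j\<in>nonzero_residues p. 1 - \<zeta> powi j) = (\<Prod>k\<in>{1..<p}. 1 - \<zeta> ^ k)"
    unfolding nonzero_residues_eq[OF prime_gt_1_nat[OF assms(1)]]
    by (subst prod.reindex) auto
  also have "\<dots> = poly (\<Prod>k\<in>{1..<p}. [:- (\<zeta> ^ k), 1:]) 1"
    by (simp add: poly_prod)
  also have "\<dots> = poly (\<Sum>i<p. monom 1 i) 1"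
    by (simp only: sum_monom_eq_prod_primitive_root[OF assms(2)])
  \<comment> \<open>Each of the \<open>p\<close> monomials takes the value 1 at 1.\<close>
  also have "\<dots> = of_nat p"
    by (simp add: poly_sum poly_monom)
  finally show ?thesis .
qed

end
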